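(* On each of the spaces $c_0$ and $\ell^p$, $1\le p<\infty$, there exists a weighted backward shift which is strongly hypercyclic but neither ultra hypercyclic nor mixing.
   Context: Here $c_0$ is the Banach space of complex sequences $x=(x_n)_{n\ge 0}$ with $x_n\to 0$, with the sup norm, and $\ell^p$ is the Banach space of complex sequences $(x_n)_{n\ge 0}$ with $\|x\|=(\sum_{n\ge 0}|x_n|^p)^{1/p}<\infty$. Let $X$ be one of these spaces. A weighted backward shift $B_w$ on $X$ is given by a bounded sequence $w=(w_n)_{n\ge 1}$ of positive numbers: it is the continuous linear operator $B_w(x_0,x_1,x_2,\dots)=(w_1x_1,w_2x_2,\dots)$. Let $T$ be a continuous linear operator on $X$. $T$ is strongly hypercyclic if, for each non-empty open subset $U$ of $X$, $X\setminus\{0\}\subseteq\bigcup_{n=0}^\infty T^n(U)$. $T$ is ultra hypercyclic if there exists a (strictly) increasing sequence $(n_k)_{k\ge 1}$ of positive integers such that, for each non-empty open subset $U$ of $X$, $X=\bigcup_{i\ge 1}\bigcap_{k\ge i}T^{n_k}(U)$ (the sequence does not depend on $U$). $T$ is mixing if for all non-empty open subsets $U,V$ of $X$ the set $N(U,V)=\{n\in\mathbb{N}_0: T^n(U)\cap V\ne\emptyset\}$ is cofinite in $\mathbb{N}_0=\{0,1,2,\dots\}$. *)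

theory Defs
  imports "HOL-Analysis.Analysis"
begin

section \<open>The sequence spaces\<close>

definition c0 :: "(nat \<Rightarrow> complex) set" where
  "c0 = {x. x \<longlonglongrightarrow> 0}"

definition c0_norm :: "(nat \<Rightarrow> complex) \<Rightarrow> real" where
  "c0_norm x = (SUP n. norm (x n))"

definition lp :: "real \<Rightarrow> (nat \<Rightarrow> complex) set" where
  "lp p = {x. summable (\<lambda>n. norm (x n) powr p)}"

definition lp_norm :: "real \<Rightarrow> (nat \<Rightarrow> complex) \<Rightarrow> real" where
  "lp_norm p x = (\<Sum>n. norm (x n) powr p) powr (1 / p)"

text \<open>The locale \<^locale>\<open>Metric_space\<close> requires the distance to be nonnegative on the
  whole type, while a norm such as \<^const>\<open>c0_norm\<close> is unspecified outside its space; hence the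
  value 0 there. Only distances between points of the carrier affect the topology.\<close>

definition norm_dist ::
  "(nat \<Rightarrow> complex) set \<Rightarrow> ((nat \<Rightarrow> complex) \<Rightarrow> real) \<Rightarrow>
    (nat \<Rightarrow> complex) \<Rightarrow> (nat \<Rightarrow> complex) \<Rightarrow> real" where
  "norm_dist X N x y = (if x \<in> X \<and> y \<in> X then N (\<lambda>n. x n - y n) else 0)"

definition norm_topology ::
  "(nat \<Rightarrow> complex) set \<Rightarrow> ((nat \<Rightarrow> complex) \<Rightarrow> real) \<Rightarrow> (nat \<Rightarrow> complex) topology" where
  "norm_topology X N = Metric_space.mtopology X (norm_dist X N)"

abbreviation c0_top :: "(nat \<Rightarrow> complex) topology" where
  "c0_top \<equiv> norm_topology c0 c0_norm"

abbreviation lp_top :: "real \<Rightarrow> (nat \<Rightarrow> complex) topology" where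
  "lp_top p \<equiv> norm_topology (lp p) (lp_norm p)"


section \<open>Weighted backward shifts\<close>

text \<open>The weights are indexed from 1; the value at 0 is irrelevant.\<close>

definition shift_weight :: "(nat \<Rightarrow> real) \<Rightarrow> bool" where
  "shift_weight w \<longleftrightarrow> (\<forall>n\<ge>1. w n > 0) \<and> bounded (w ` {1..})"

definition weighted_shift :: "(nat \<Rightarrow> real) \<Rightarrow> (nat \<Rightarrow> complex) \<Rightarrow> (nat \<Rightarrow> complex)" where
  "weighted_shift w x = (\<lambda>n. complex_of_real (w (Suc n)) * x (Suc n))"


section \<open>Dynamical notions\<close>

definition strongly_hypercyclic ::
  "(nat \<Rightarrow> complex) topology \<Rightarrow> ((nat \<Rightarrow> complex) \<Rightarrow> (nat \<Rightarrow> complex)) \<Rightarrow> bool" where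
  "strongly_hypercyclic X T \<longleftrightarrow>
    (\<forall>U. openin X U \<and> U \<noteq> {} \<longrightarrow> topspace X - {\<lambda>_. 0} \<subseteq> (\<Union>n. (T ^^ n) ` U))"

definition ultra_hypercyclic ::
  "(nat \<Rightarrow> complex) topology \<Rightarrow> ((nat \<Rightarrow> complex) \<Rightarrow> (nat \<Rightarrow> complex)) \<Rightarrow> bool" where
  "ultra_hypercyclic X T \<longleftrightarrow>
    (\<exists>nk :: nat \<Rightarrow> nat. strict_mono_on {1..} nk \<and> (\<forall>k\<ge>1. nk k > 0) \<and>
      (\<forall>U. openin X U \<and> U \<noteq> {} \<longrightarrow>
        topspace X = (\<Union>i\<in>{1..}. \<Inter>k\<in>{i..}. (T ^^ nk k) ` U)))"

definition return_set ::
  "((nat \<Rightarrow> complex) \<Rightarrow> (nat \<Rightarrow> complex)) \<Rightarrow> (nat \<Rightarrow> complex) set \<Rightarrow> (nat \<Rightarrow> complex) set \<Rightarrow> nat set"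
  where
  "return_set T U V = {n. (T ^^ n) ` U \<inter> V \<noteq> {}}"

definition mixing ::
  "(nat \<Rightarrow> complex) topology \<Rightarrow> ((nat \<Rightarrow> complex) \<Rightarrow> (nat \<Rightarrow> complex)) \<Rightarrow> bool" where
  "mixing X T \<longleftrightarrow>
    (\<forall>U V. openin X U \<and> U \<noteq> {} \<and> openin X V \<and> V \<noteq> {} \<longrightarrow> finite (- return_set T U V))"


section \<open>The norms induce metrics, and the shifts are continuous linear operators\<close>

lemma Metric_space_norm_dist:
  assumes diff: "\<And>x y. x \<in> X \<Longrightarrow> y \<in> X \<Longrightarrow> (\<lambda>n. x n - y n) \<in> X"
    and nn: "\<And>x. x \<in> X \<Longrightarrow> N x \<ge> 0"
    and neg: "\<And>x. x \<in> X \<Longrightarrow> N (\<lambda>n. - x n) = N x"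
    and zero: "\<And>x. x \<in> X \<Longrightarrow> N x = 0 \<longleftrightarrow> x = (\<lambda>_. 0)"
    and tri: "\<And>x y. x \<in> X \<Longrightarrow> y \<in> X \<Longrightarrow> N (\<lambda>n. x n + y n) \<le> N x + N y"
  shows "Metric_space X (norm_dist X N)"
proof
  fix x y
  show "0 \<le> norm_dist X N x y" using diff nn by (simp add: norm_dist_def)
  show "norm_dist X N x y = norm_dist X N y x"
    using neg[OF diff, of x y] by (auto simp: norm_dist_def)
next
  fix x y assume "x \<in> X" "y \<in> X"
  then show "norm_dist X N x y = 0 \<longleftrightarrow> x = y"
    using zero[OF diff, of x y] by (auto simp: norm_dist_def fun_eq_iff)
next
  fix x y z assume "x \<in> X" "y \<in> X" "z \<in> X"
  then show "norm_dist X N x z \<le> norm_dist X N x y + norm_dist X N y z"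
    using tri[OF diff diff, of x y y z] by (simp add: norm_dist_def)
qed

lemma c0_bdd: "x \<in> c0 \<Longrightarrow> bdd_above (range (\<lambda>n. norm (x n)))"
  unfolding c0_def using Bseq_eq_bounded[of x] convergent_imp_Bseq[of x]
  by (auto simp: convergent_def bounded_iff bdd_above_def)

lemma c0_norm_upper: "x \<in> c0 \<Longrightarrow> norm (x n) \<le> c0_norm x"
  unfolding c0_norm_def by (intro cSUP_upper c0_bdd) auto

lemma c0_norm_le: "(\<And>n. norm (x n) \<le> C) \<Longrightarrow> c0_norm x \<le> C"
  unfolding c0_norm_def by (intro cSUP_least) auto

lemma c0_diff: "x \<in> c0 \<Longrightarrow> y \<in> c0 \<Longrightarrow> (\<lambda>n. x n - y n) \<in> c0"
  unfolding c0_def using tendsto_diff[of x 0 sequentially y 0] by simp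

lemma Metric_space_c0: "Metric_space c0 (norm_dist c0 c0_norm)"
proof (rule Metric_space_norm_dist)
  fix x y assume x: "x \<in> c0" and y: "y \<in> c0"
  show "(\<lambda>n. x n - y n) \<in> c0" using x y by (rule c0_diff)
  show "c0_norm (\<lambda>n. x n + y n) \<le> c0_norm x + c0_norm y"
    by (intro c0_norm_le norm_triangle_le add_mono c0_norm_upper x y)
next
  fix x assume x: "x \<in> c0"
  show "0 \<le> c0_norm x" using c0_norm_upper[OF x, of 0] norm_ge_zero order_trans by blast
  show "c0_norm (\<lambda>n. - x n) = c0_norm x" by (simp add: c0_norm_def)
  show "c0_norm x = 0 \<longleftrightarrow> x = (\<lambda>_. 0)"
    using c0_norm_upper[OF x] by (auto simp: c0_norm_def fun_eq_iff)
qed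

lemma powr_convex_ge0:
  fixes a b u p :: real
  assumes "a \<ge> 0" "b \<ge> 0" "0 \<le> u" "u \<le> 1" "p \<ge> 1"
  shows "(u * a + (1 - u) * b) powr p \<le> u * a powr p + (1 - u) * b powr p"
proof -
  have small: "t powr p \<le> t" if "0 \<le> t" "t \<le> 1" for t :: real
    using powr_mono'[of 1 p t] that assms by simp
  consider "a = 0" | "b = 0" | "a > 0" "b > 0" using assms by linarith
  then show ?thesis
  proof cases
    case 1
    then show ?thesis using assms small[of "1 - u"] by (simp add: powr_mult mult_right_mono)
  next
    case 2
    then show ?thesis using assms small[of u] by (simp add: powr_mult mult_right_mono)
  next
    case 3
    then show ?thesis
      using convex_onD[OF powr_convex[OF \<open>p \<ge> 1\<close>], of u b a] assms
      by (simp add: algebra_simps)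
  qed
qed

lemma lp_norm_powr: "p \<ge> 1 \<Longrightarrow> x \<in> lp p \<Longrightarrow> lp_norm p x powr p = (\<Sum>n. norm (x n) powr p)"
  unfolding lp_norm_def lp_def by (simp add: powr_powr suminf_nonneg)

lemma lp_norm_zero_iff:
  assumes "p \<ge> 1" "x \<in> lp p" shows "lp_norm p x = 0 \<longleftrightarrow> x = (\<lambda>_. 0)"
  using assms suminf_eq_zero_iff[of "\<lambda>n. norm (x n) powr p"]
  by (auto simp: lp_norm_def lp_def fun_eq_iff)

lemma lp_norm_scaled:
  assumes "p \<ge> 1" "x \<in> lp p" "lp_norm p x > 0"
  shows "(\<lambda>n. (norm (x n) / lp_norm p x) powr p) sums 1"
proof -
  have "(\<lambda>n. norm (x n) powr p) sums (lp_norm p x powr p)"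
    using assms by (simp add: lp_norm_powr) (simp add: lp_def summable_sums)
  from sums_divide[OF this, of "lp_norm p x powr p"] show ?thesis
    using assms by (simp add: powr_divide)
qed

lemma lp_minkowski:
  assumes p: "p \<ge> 1" and x: "x \<in> lp p" and y: "y \<in> lp p"
  shows "(\<lambda>n. x n + y n) \<in> lp p \<and> lp_norm p (\<lambda>n. x n + y n) \<le> lp_norm p x + lp_norm p y"
proof (cases "lp_norm p x = 0 \<or> lp_norm p y = 0")
  case True
  then show ?thesis using lp_norm_zero_iff p x y by (auto simp: lp_norm_def)
next
  case False
  define A B where "A = lp_norm p x" and "B = lp_norm p y"
  have AB: "A > 0" "B > 0"
    using False by (auto simp: A_def B_def lp_norm_def less_le)
  define u where "u = A / (A + B)"
  have u: "0 \<le> u" "u \<le> 1" "1 - u = B / (A + B)" using AB by (auto simp: u_def field_simps)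
  define g where "g n = u * (norm (x n) / A) powr p + (1 - u) * (norm (y n) / B) powr p" for n
  have g: "g sums 1"
    using sums_add[OF sums_mult[OF lp_norm_scaled[OF p x], of u]
        sums_mult[OF lp_norm_scaled[OF p y], of "1 - u"]] AB
    by (simp add: g_def[abs_def] A_def B_def)
  have le: "norm (x n + y n) powr p \<le> (A + B) powr p * g n" for n
  proof -
    have "norm (x n + y n) \<le> (A + B) * (u * (norm (x n) / A) + (1 - u) * (norm (y n) / B))"
      using AB norm_triangle_ineq[of "x n" "y n"] unfolding u(3) by (simp add: u_def distrib_left)
    then have "norm (x n + y n) powr p
        \<le> ((A + B) * (u * (norm (x n) / A) + (1 - u) * (norm (y n) / B))) powr p"
      using p by (intro powr_mono2) auto
    also have "\<dots> = (A + B) powr p * (u * (norm (x n) / A) + (1 - u) * (norm (y n) / B)) powr p"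
      by (rule powr_mult)
    also have "\<dots> \<le> (A + B) powr p * g n"
      unfolding g_def using AB u p by (intro mult_left_mono powr_convex_ge0) auto
    finally show ?thesis .
  qed
  have G: "(\<lambda>n. (A + B) powr p * g n) sums ((A + B) powr p)"
    using sums_mult[OF g, of "(A + B) powr p"] by simp
  have S: "summable (\<lambda>n. norm (x n + y n) powr p)"
    using le by (intro summable_comparison_test'[OF sums_summable[OF G], of 0]) auto
  have "(\<Sum>n. norm (x n + y n) powr p) \<le> (A + B) powr p"
    using suminf_le[OF le S sums_summable[OF G]] sums_unique[OF G] by simp
  then have "lp_norm p (\<lambda>n. x n + y n) \<le> ((A + B) powr p) powr (1 / p)"
    unfolding lp_norm_def using p by (intro powr_mono2 suminf_nonneg S) auto
  also have "\<dots> = A + B" using p AB by (simp add: powr_powr)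
  finally show ?thesis using S by (simp add: lp_def A_def B_def)
qed

lemma lp_uminus: "x \<in> lp p \<Longrightarrow> (\<lambda>n. - x n) \<in> lp p"
  by (simp add: lp_def)

lemma lp_diff: "p \<ge> 1 \<Longrightarrow> x \<in> lp p \<Longrightarrow> y \<in> lp p \<Longrightarrow> (\<lambda>n. x n - y n) \<in> lp p"
  using lp_minkowski[of p x "\<lambda>n. - y n"] lp_uminus[of y p] by simp

lemma Metric_space_lp:
  assumes p: "p \<ge> 1" shows "Metric_space (lp p) (norm_dist (lp p) (lp_norm p))"
proof (rule Metric_space_norm_dist)
  fix x y assume "x \<in> lp p" "y \<in> lp p"
  then show "(\<lambda>n. x n - y n) \<in> lp p" "lp_norm p (\<lambda>n. x n + y n) \<le> lp_norm p x + lp_norm p y"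
    using lp_diff lp_minkowski p by auto
next
  fix x assume "x \<in> lp p"
  then show "0 \<le> lp_norm p x" "lp_norm p (\<lambda>n. - x n) = lp_norm p x"
    "lp_norm p x = 0 \<longleftrightarrow> x = (\<lambda>_. 0)"
    using lp_norm_zero_iff p by (auto simp: lp_norm_def)
qed

lemma topspace_c0_top [simp]: "topspace c0_top = c0"
  by (simp add: norm_topology_def Metric_space.topspace_mtopology[OF Metric_space_c0])

lemma topspace_lp_top [simp]: "p \<ge> 1 \<Longrightarrow> topspace (lp_top p) = lp p"
  by (simp add: norm_topology_def Metric_space.topspace_mtopology[OF Metric_space_lp])

lemma openin_norm_topology:
  assumes "Metric_space X (norm_dist X N)"
  shows "openin (norm_topology X N) U \<longleftrightarrow>
    U \<subseteq> X \<and> (\<forall>x\<in>U. \<exists>e>0. \<forall>y\<in>X. N (\<lambda>n. x n - y n) < e \<longrightarrow> y \<in> U)"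
proof (cases "U \<subseteq> X")
  case True
  have "Metric_space.mball X (norm_dist X N) x e \<subseteq> U \<longleftrightarrow>
      (\<forall>y\<in>X. N (\<lambda>n. x n - y n) < e \<longrightarrow> y \<in> U)" if "x \<in> U" for x e
  proof -
    have "x \<in> X" using that True by (rule subsetD[rotated])
    then have "y \<in> Metric_space.mball X (norm_dist X N) x e \<longleftrightarrow>
        y \<in> X \<and> N (\<lambda>n. x n - y n) < e" for y
      by (auto simp: Metric_space.in_mball[OF assms] norm_dist_def)
    then show ?thesis unfolding subset_iff by metis
  qed
  with True show ?thesis
    unfolding norm_topology_def Metric_space.openin_mtopology[OF assms] Ball_def by metis
qed (simp add: norm_topology_def Metric_space.openin_mtopology[OF assms])

lemma weighted_shift_linear:
  "weighted_shift w (\<lambda>n. a * x n + b * y n)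
    = (\<lambda>n. a * weighted_shift w x n + b * weighted_shift w y n)"
  by (simp add: weighted_shift_def algebra_simps)

lemma shift_weight_bound:
  assumes "shift_weight w"
  obtains C where "C > 0" "\<And>x n. norm (weighted_shift w x n) \<le> C * norm (x (Suc n))"
proof -
  obtain C where "C > 0" and *: "\<forall>y\<in>w ` {1..}. norm y \<le> C"
    using assms unfolding shift_weight_def bounded_pos by blast
  have "norm (weighted_shift w x n) \<le> C * norm (x (Suc n))" for x n
  proof -
    have "\<bar>w (Suc n)\<bar> \<le> C" using * by force
    then have "\<bar>w (Suc n)\<bar> * norm (x (Suc n)) \<le> C * norm (x (Suc n))"
      by (rule mult_right_mono) (rule norm_ge_zero)
    then show ?thesis by (simp only: weighted_shift_def norm_mult norm_of_real)
  qed
  then show thesis using that \<open>C > 0\<close> by blast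
qed

lemma continuous_map_norm_topology:
  assumes M: "Metric_space X (norm_dist X N)"
    and T: "\<And>x. x \<in> X \<Longrightarrow> T x \<in> X"
    and lin: "\<And>x y. (\<lambda>n. T x n - T y n) = T (\<lambda>n. x n - y n)"
    and diff: "\<And>x y. x \<in> X \<Longrightarrow> y \<in> X \<Longrightarrow> (\<lambda>n. x n - y n) \<in> X"
    and bd: "\<And>x. x \<in> X \<Longrightarrow> N (T x) \<le> C * N x"
  shows "continuous_map (norm_topology X N) (norm_topology X N) T"
proof -
  have "mspace (metric (X, norm_dist X N)) = X" "mdist (metric (X, norm_dist X N)) = norm_dist X N"
    by (rule Metric_space.mspace_metric[OF M], rule Metric_space.mdist_metric[OF M])
  note [simp] = this
  have "norm_dist X N (T x) (T y) \<le> C * norm_dist X N x y" if "x \<in> X" "y \<in> X" for x y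
    using bd[OF diff[OF that]] that T by (simp add: norm_dist_def lin[of x y])
  then have "Lipschitz_continuous_map (metric (X, norm_dist X N)) (metric (X, norm_dist X N)) T"
    unfolding Lipschitz_continuous_map_def using T by (intro conjI exI[of _ C]) auto
  from Lipschitz_continuous_imp_continuous_map[OF this] show ?thesis
    by (simp add: mtopology_of_def norm_topology_def)
qed

lemma weighted_shift_diff:
  "(\<lambda>n. weighted_shift w x n - weighted_shift w y n) = weighted_shift w (\<lambda>n. x n - y n)"
  by (simp add: weighted_shift_def algebra_simps)

lemma weighted_shift_c0:
  assumes "shift_weight w"
  shows "x \<in> c0 \<Longrightarrow> weighted_shift w x \<in> c0"
    and "continuous_map c0_top c0_top (weighted_shift w)"
proof -
  obtain C where C: "C > 0" "\<And>x n. norm (weighted_shift w x n) \<le> C * norm (x (Suc n))"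
    using shift_weight_bound[OF assms] by blast
  have T: "weighted_shift w x \<in> c0" if "x \<in> c0" for x
  proof -
    have "(\<lambda>n. C * norm (x (Suc n))) \<longlonglongrightarrow> 0"
      using that unfolding c0_def
      by (auto intro!: tendsto_mult_right_zero tendsto_norm_zero LIMSEQ_Suc)
    then show ?thesis unfolding c0_def
      using Lim_null_comparison[of "weighted_shift w x" "\<lambda>n. C * norm (x (Suc n))"] C(2) by auto
  qed
  then show "x \<in> c0 \<Longrightarrow> weighted_shift w x \<in> c0" .
  have bd: "c0_norm (weighted_shift w x) \<le> C * c0_norm x" if "x \<in> c0" for x
    using C(1) by (intro c0_norm_le order_trans[OF C(2)] mult_left_mono c0_norm_upper that) auto
  show "continuous_map c0_top c0_top (weighted_shift w)"
  proof (rule continuous_map_norm_topology[where C = C])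
    show "Metric_space c0 (norm_dist c0 c0_norm)" by (rule Metric_space_c0)
  qed (fact T weighted_shift_diff c0_diff bd)+
qed

lemma weighted_shift_lp:
  assumes "shift_weight w" and p: "p \<ge> 1"
  shows "x \<in> lp p \<Longrightarrow> weighted_shift w x \<in> lp p"
    and "continuous_map (lp_top p) (lp_top p) (weighted_shift w)"
proof -
  obtain C where C: "C > 0" "\<And>x n. norm (weighted_shift w x n) \<le> C * norm (x (Suc n))"
    using shift_weight_bound[OF assms(1)] by blast
  have le: "norm (weighted_shift w x n) powr p \<le> C powr p * norm (x (Suc n)) powr p" for x n
  proof -
    have "norm (weighted_shift w x n) powr p \<le> (C * norm (x (Suc n))) powr p"
      by (rule powr_mono2[OF _ _ C(2)]) (use p in auto)
    then show ?thesis by (simp only: powr_mult)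
  qed
  have S: "summable (\<lambda>n. C powr p * norm (x (Suc n)) powr p)" if "x \<in> lp p" for x
  proof (rule summable_mult)
    have "summable (\<lambda>n. norm (x n) powr p)" using that by (simp add: lp_def)
    then show "summable (\<lambda>n. norm (x (Suc n)) powr p)"
      by (rule iffD2[OF summable_Suc_iff])
  qed
  have T: "weighted_shift w x \<in> lp p" if "x \<in> lp p" for x
  proof -
    have "norm (norm (weighted_shift w x n) powr p) \<le> C powr p * norm (x (Suc n)) powr p" for n
      using le[of x n] by simp
    from summable_comparison_test'[OF S[OF that] this] show ?thesis by (simp add: lp_def)
  qed
  then show "x \<in> lp p \<Longrightarrow> weighted_shift w x \<in> lp p" .
  have bd: "lp_norm p (weighted_shift w x) \<le> C * lp_norm p x" if x: "x \<in> lp p" for x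
  proof -
    have sx: "summable (\<lambda>n. norm (x n) powr p)" using x by (simp add: lp_def)
    then have sx': "summable (\<lambda>n. norm (x (Suc n)) powr p)"
      by (rule iffD2[OF summable_Suc_iff])
    have "(\<Sum>n. norm (weighted_shift w x n) powr p) \<le> (\<Sum>n. C powr p * norm (x (Suc n)) powr p)"
      using T[OF x] by (intro suminf_le le S x) (simp add: lp_def)
    also have "\<dots> = C powr p * (\<Sum>n. norm (x (Suc n)) powr p)"
      by (rule suminf_mult[OF sx'])
    also have "\<dots> \<le> C powr p * (\<Sum>n. norm (x n) powr p)"
      using suminf_split_head[OF sx] by (intro mult_left_mono) auto
    finally have "lp_norm p (weighted_shift w x)
        \<le> (C powr p * (\<Sum>n. norm (x n) powr p)) powr (1 / p)"
      unfolding lp_norm_def using p T[OF x]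
      by (intro powr_mono2 suminf_nonneg) (auto simp: lp_def)
    also have "\<dots> = C * lp_norm p x"
      using C(1) p sx by (simp add: lp_norm_def powr_mult suminf_nonneg powr_powr)
    finally show ?thesis .
  qed
  show "continuous_map (lp_top p) (lp_top p) (weighted_shift w)"
  proof (rule continuous_map_norm_topology[where C = C])
    show "Metric_space (lp p) (norm_dist (lp p) (lp_norm p))" by (rule Metric_space_lp[OF p])
  qed (fact T weighted_shift_diff lp_diff[OF p] bd)+
qed

end

theory Submission
  imports Defs
begin

text \<open>One weight sequence serves all the spaces. Write \<open>M n = w 1 * \<dots> * w n\<close> for the products of
the weights. Then \<open>B\<^sub>w\<^sup>n x\<close> has \<open>j\<close>-th coordinate \<open>M (j + n) / M j * x (j + n)\<close>, so the first \<open>n\<close>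
coordinates of a preimage of \<open>y\<close> under \<open>B\<^sub>w\<^sup>n\<close> are arbitrary and the others form the sequence
\<open>S\<^sub>n y = (M j / M (j + n) * y j)\<^sub>j\<close>, moved \<open>n\<close> places to the right. For large \<open>n\<close>, the vector \<open>y\<close> is
therefore in \<open>B\<^sub>w\<^sup>n U\<close> for every open \<open>U\<close> as soon as \<open>S\<^sub>n y\<close> is small, and strong hypercyclicity asks that
each \<open>y\<close> have arbitrarily large \<open>n\<close> with \<open>S\<^sub>n y\<close> small. Ultra hypercyclicity asks for one sequence of
\<open>n\<close> along which \<open>S\<^sub>n y\<close> tends to 0 for all \<open>y\<close>, so by the uniform boundedness principle the norms of these
\<open>S\<^sub>n\<close> must eventually stay bounded. To separate the two notions, \<open>S\<^sub>n\<close> has to be small on long initial segments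
only at the price of a large norm, attained far out and so harmless for a given \<open>y\<close>.

Put \<open>M n = 2 ^ h n\<close>, where \<open>h\<close> is the following staircase. Start from the block consisting of the single
value 0. Stage \<open>s\<close> replaces the current block, of length \<open>L\<close>, by the concatenation of its
copies raised by \<open>0, 1, \<dots>, k, \<dots>, 1, 0\<close>, where \<open>k\<close> is the peak of that stage; every positive integer
is the peak of infinitely many stages. Three facts carry the proof.

\<^item> A shift by \<open>k * L\<close> raises the values on the initial segment of length \<open>L\<close> by \<open>k\<close>
  (\<open>height_raised_copy\<close>), and lowers no value at all by more than \<open>k\<close>
  (\<open>height_add_multiple_period\<close>): a shift by \<open>L\<close> changes \<open>h\<close> by at most 1, since neighbouring
  copies differ by at most 1 in height and every block begins and ends at 0. For \<open>n = k * L\<close> the norm of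
  \<open>S\<^sub>n y\<close> is thus at most \<open>2 ^ - k\<close> times the norm of \<open>y\<close>, plus \<open>2 ^ k\<close> times the norm of the tail of \<open>y\<close>
  from \<open>L\<close> on. Fix \<open>k\<close> large and let \<open>L\<close> tend to infinity through the stages with peak \<open>k\<close>:
  this gives strong hypercyclicity.

\<^item> Every block ends at height 0, so \<open>M n = 1\<close> for infinitely many \<open>n\<close>, which excludes mixing.

\<^item> Blocks are palindromes (\<open>height_palindrome\<close>). With \<open>j = L - 1 - n\<close> this gives \<open>M j = M n\<close> and
  \<open>M (j + n) = 1\<close>, so the norm of \<open>S\<^sub>n\<close> is at least \<open>M n\<close>. Along a sequence witnessing ultra
  hypercyclicity \<open>M n\<close> tends to infinity, as multiples of the first unit vector show; a gliding hump
  then produces a vector \<open>y\<close> with \<open>S\<^sub>n y\<close> of norm at least 1 infinitely often.\<close>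

section \<open>The staircase\<close>

definition tent :: "nat \<Rightarrow> nat \<Rightarrow> nat" where
  "tent k d = min d (2 * k - d)"

text \<open>Decoding pairs makes every positive integer the peak of infinitely many stages.\<close>

definition peak :: "nat \<Rightarrow> nat" where
  "peak m = Suc (fst (prod_decode m))"

definition base :: "nat \<Rightarrow> nat" where
  "base m = 2 * peak m + 1"

lemma base_ge3: "base m \<ge> 3"
  by (simp add: base_def peak_def)

text \<open>The staircase is \<open>height 0\<close>. Its value at \<open>q\<close> is the sum of the tents of the digits of \<open>q\<close> in the
mixed radix system with bases \<^const>\<open>base\<close>: the digit of \<open>q\<close> at stage \<open>s\<close> says which raised copy of
the stage-\<open>s\<close> block \<open>q\<close> lies in. Starting the digits at an arbitrary stage \<open>m\<close> makes induction
from the least significant digit possible.\<close>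

function height :: "nat \<Rightarrow> nat \<Rightarrow> nat" where
  "height m q =
    (if q = 0 then 0 else tent (peak m) (q mod base m) + height (Suc m) (q div base m))"
  by auto
termination
proof (relation "Wellfounded.measure snd")
  fix m q :: nat assume "q \<noteq> 0"
  then show "((Suc m, q div base m), (m, q)) \<in> Wellfounded.measure snd"
    using base_ge3[of m] by (auto intro!: div_less_dividend)
qed simp

declare height.simps [simp del]

lemma height_0 [simp]: "height m 0 = 0"
  by (simp add: height.simps)

lemma height_rec:
  "height m q = tent (peak m) (q mod base m) + height (Suc m) (q div base m)"
  by (cases "q = 0") (simp_all add: height.simps[of m] tent_def)

lemma height_digit_add:
  "d < base m \<Longrightarrow> height m (d + base m * q) = tent (peak m) d + height (Suc m) q"
  using height_rec[of m "d + base m * q"] by simp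

text \<open>The length of the block built by the stages \<open>m, \<dots>, m + s - 1\<close>.\<close>

primrec period :: "nat \<Rightarrow> nat \<Rightarrow> nat" where
  "period m 0 = 1"
| "period m (Suc s) = base m * period (Suc m) s"

lemma period_gt: "s < period m s"
proof (induction s arbitrary: m)
  case (Suc s)
  have "Suc s < 3 * period (Suc m) s" using Suc[of "Suc m"] by simp
  also have "\<dots> \<le> period m (Suc s)" using base_ge3 by (simp add: mult_right_mono)
  finally show ?case .
qed simp

text \<open>Without a carry, one tent moves by at most 1. With a carry, the last digit drops from \<open>2 * peak m\<close> to 0;
the tent vanishes at both, so only the carry into the next digit counts.\<close>

lemma height_Suc_close: "height m (Suc q) \<le> Suc (height m q) \<and> height m q \<le> Suc (height m (Suc q))"
proof (induction q arbitrary: m rule: less_induct)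
  case (less q)
  define d where "d = q mod base m"
  define a where "a = q div base m"
  have q: "q = d + base m * a" by (simp add: d_def a_def)
  have d: "d < base m" using base_ge3[of m] by (simp add: d_def)
  show ?case
  proof (cases "Suc d < base m")
    case True
    have "height m (Suc q) = tent (peak m) (Suc d) + height (Suc m) a"
      using height_digit_add[OF True, of a] by (simp add: q)
    moreover have "tent (peak m) (Suc d) \<le> Suc (tent (peak m) d)"
      "tent (peak m) d \<le> Suc (tent (peak m) (Suc d))"
      by (simp_all add: tent_def)
    ultimately show ?thesis using height_digit_add[OF d, of a] by (simp add: q)
  next
    case False
    then have d': "d = 2 * peak m" using d by (simp add: base_def)
    have "Suc q = 0 + base m * Suc a" using d' by (simp add: q base_def)
    then have "height m (Suc q) = height (Suc m) (Suc a)"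
      using height_digit_add[of 0 m "Suc a"] base_ge3[of m] by (simp add: tent_def)
    moreover have "height m q = height (Suc m) a"
      using height_digit_add[OF d, of a] d' by (simp add: q tent_def)
    moreover have "a < q"
      using d' base_ge3[of m] by (auto simp: q base_def peak_def)
    ultimately show ?thesis using less[of a "Suc m"] by simp
  qed
qed

text \<open>Adding a period leaves the lower digits alone and adds 1 to the number formed by the higher ones.\<close>

lemma height_add_period_close: "height m q \<le> Suc (height m (q + period m s))"
proof (induction s arbitrary: m q)
  case 0
  then show ?case using height_Suc_close[of m q] by simp
next
  case (Suc s)
  have "(q + period m (Suc s)) mod base m = q mod base m"
    and "(q + period m (Suc s)) div base m = q div base m + period (Suc m) s"
    using base_ge3[of m] by simp_all
  then show ?case
    using Suc[of "Suc m" "q div base m"]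
    by (simp add: height_rec[of m "q + period m (Suc s)"] height_rec[of m q] del: period.simps)
qed

text \<open>The bound on the drop is uniform in \<open>q\<close>, however many carries occur. This bounds the norm of
\<open>S\<^sub>n\<close> for \<open>n = c * period m s\<close>.\<close>

lemma height_add_multiple_period: "height m q \<le> c + height m (q + c * period m s)"
proof (induction c)
  case (Suc c)
  then show ?case
    using height_add_period_close[of m "q + c * period m s" s] by (simp add: algebra_simps)
qed simp

text \<open>The digits of \<open>q\<close> stay and \<open>d\<close> becomes the next digit, on the ascending side of the tent.\<close>

lemma height_raised_copy:
  "q < period m s \<Longrightarrow> d \<le> peak (m + s) \<Longrightarrow> height m (q + d * period m s) = height m q + d"
proof (induction s arbitrary: m q)
  case 0
  then show ?case using height_digit_add[of d m 0] by (simp add: base_def tent_def)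
next
  case (Suc s)
  have eq: "q + d * period m (Suc s) = q + base m * (d * period (Suc m) s)" by simp
  have "(q + d * period m (Suc s)) mod base m = q mod base m"
    and "(q + d * period m (Suc s)) div base m = q div base m + d * period (Suc m) s"
    unfolding eq using base_ge3[of m] by simp_all
  moreover have "q div base m < period (Suc m) s"
    using Suc.prems(1) base_ge3[of m] by (simp add: less_mult_imp_div_less mult.commute)
  ultimately show ?case
    using Suc.IH[of "q div base m" "Suc m"] Suc.prems(2)
    by (simp add: height_rec[of m "q + d * period m (Suc s)"] height_rec[of m q] del: period.simps)
qed

text \<open>Reflecting a block replaces each digit \<open>d\<close> by \<open>2 * peak - d\<close>, and tents are symmetric.\<close>

lemma height_palindrome: "q < period m s \<Longrightarrow> height m (period m s - 1 - q) = height m q"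
proof (induction s arbitrary: m q)
  case (Suc s)
  define d where "d = q mod base m"
  define a where "a = q div base m"
  have q: "q = d + base m * a" by (simp add: d_def a_def)
  have d: "d < base m" using base_ge3[of m] by (simp add: d_def)
  have a: "a < period (Suc m) s"
    using Suc.prems(1) base_ge3[of m] by (simp add: a_def less_mult_imp_div_less mult.commute)
  then obtain b where b: "period (Suc m) s = a + 1 + b"
    by (metis add.commute less_iff_Suc_add plus_1_eq_Suc add.assoc)
  have "period m (Suc s) - 1 - q = (2 * peak m - d) + base m * b"
    using d by (simp add: b q algebra_simps base_def)
  also have "height m \<dots> = tent (peak m) (2 * peak m - d) + height (Suc m) b"
    by (rule height_digit_add) (simp add: base_def)
  also have "tent (peak m) (2 * peak m - d) = tent (peak m) d"
    using d by (simp add: tent_def base_def)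
  also have "height (Suc m) b = height (Suc m) a"
    using Suc.IH[OF a] by (simp add: b)
  finally show ?case using height_digit_add[OF d, of a] by (simp add: q)
qed simp

lemma height_period_pred: "height m (period m s - 1) = 0"
  using height_palindrome[of 0 m s] period_gt[of s m] by simp

section \<open>The weights\<close>

text \<open>These are the products of the weights, from which the weights are recovered as quotients.\<close>

definition growth :: "nat \<Rightarrow> real" where
  "growth n = 2 ^ height 0 n"

definition tower_weight :: "nat \<Rightarrow> real" where
  "tower_weight n = growth n / growth (n - 1)"

lemma growth_pos [simp]: "growth n > 0"
  by (simp add: growth_def)

lemma growth_0 [simp]: "growth 0 = 1"
  by (simp add: growth_def)

lemma shift_weight_tower: "shift_weight tower_weight"
proof -
  have "tower_weight n \<in> {0..2}" if "n \<ge> 1" for n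
  proof -
    obtain q where n: "n = Suc q" using \<open>n \<ge> 1\<close> by (cases n) auto
    have "growth (Suc q) \<le> 2 ^ Suc (height 0 q)"
      unfolding growth_def using height_Suc_close[of 0 q] by (intro power_increasing) auto
    then show ?thesis
      using growth_pos[of "Suc q"] growth_pos[of q]
      by (simp add: tower_weight_def n growth_def field_simps)
  qed
  then have "tower_weight ` {1..} \<subseteq> {0..2}" by auto
  then have "bounded (tower_weight ` {1..})" by (rule bounded_subset[OF bounded_closed_interval])
  then show ?thesis by (simp add: shift_weight_def tower_weight_def)
qed

lemma tower_shift_power:
  "(weighted_shift tower_weight ^^ n) x = (\<lambda>j. of_real (growth (j + n) / growth j) * x (j + n))"
proof (induction n)
  case 0
  show ?case by (simp add: less_imp_neq[OF growth_pos, symmetric])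
next
  case (Suc n)
  then show ?case
    by (simp add: weighted_shift_def tower_weight_def less_imp_neq[OF growth_pos, symmetric])
qed

section \<open>Dynamics on solid sequence spaces\<close>

definition unit_seq :: "nat \<Rightarrow> complex" where
  "unit_seq = (\<lambda>n. if n = 0 then 1 else 0)"

definition tail :: "nat \<Rightarrow> (nat \<Rightarrow> complex) \<Rightarrow> (nat \<Rightarrow> complex)" where
  "tail J x = (\<lambda>i. if i < J then 0 else x i)"

text \<open>What the argument uses of \<^term>\<open>c0\<close> and \<^term>\<open>lp p\<close>. Allowing a displacement by \<open>n\<close> places in the
domination axiom combines solidity, homogeneity up to inequality, and the fact that the forward shift does not increase the norm.\<close>

locale solid_sequence_space =
  fixes X :: "(nat \<Rightarrow> complex) set" and N :: "(nat \<Rightarrow> complex) \<Rightarrow> real"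
  assumes metric: "Metric_space X (norm_dist X N)"
    and add: "x \<in> X \<Longrightarrow> y \<in> X \<Longrightarrow> (\<lambda>n. x n + y n) \<in> X \<and> N (\<lambda>n. x n + y n) \<le> N x + N y"
    and dominated: "y \<in> X \<Longrightarrow> C \<ge> 0 \<Longrightarrow> (\<And>i. i < n \<Longrightarrow> z i = 0) \<Longrightarrow>
      (\<And>i. norm (z (i + n)) \<le> C * norm (y i)) \<Longrightarrow> z \<in> X \<and> N z \<le> C * N y"
    and coordinate: "x \<in> X \<Longrightarrow> norm (x i) \<le> N x"
    and tail_null: "x \<in> X \<Longrightarrow> (\<lambda>J. N (tail J x)) \<longlonglongrightarrow> 0"
    and absolutely_summable: "summable (\<lambda>n. norm (x n)) \<Longrightarrow> x \<in> X"
begin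

abbreviation B :: "(nat \<Rightarrow> complex) \<Rightarrow> (nat \<Rightarrow> complex)" where
  "B \<equiv> weighted_shift tower_weight"

lemma zero_in: "(\<lambda>_. 0) \<in> X"
  by (rule absolutely_summable) simp

lemma unit_in: "(\<lambda>n. c * unit_seq n) \<in> X"
  by (rule absolutely_summable) (rule summable_finite[of "{0}"], auto simp: unit_seq_def)

lemma solid:
  assumes "y \<in> X" "\<And>i. norm (z i) \<le> norm (y i)"
  shows "z \<in> X" "N z \<le> N y"
  using dominated[of y 1 0 z] assms by auto

lemma diff:
  assumes "x \<in> X" "y \<in> X"
  shows "(\<lambda>n. x n - y n) \<in> X" "N (\<lambda>n. x n - y n) \<le> N x + N y"
proof -
  have "(\<lambda>n. - y n) \<in> X" "N (\<lambda>n. - y n) \<le> N y"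
    using solid[OF \<open>y \<in> X\<close>, of "\<lambda>n. - y n"] by auto
  then show "(\<lambda>n. x n - y n) \<in> X" "N (\<lambda>n. x n - y n) \<le> N x + N y"
    using add[OF \<open>x \<in> X\<close>, of "\<lambda>n. - y n"] by auto
qed

lemma tail_in: "x \<in> X \<Longrightarrow> tail J x \<in> X"
  by (rule solid(1)) (auto simp: tail_def)

definition norm_ball :: "(nat \<Rightarrow> complex) \<Rightarrow> real \<Rightarrow> (nat \<Rightarrow> complex) set" where
  "norm_ball c e = {x \<in> X. N (\<lambda>n. c n - x n) < e}"

lemma topspace_norm_topology: "topspace (norm_topology X N) = X"
  by (simp add: norm_topology_def Metric_space.topspace_mtopology[OF metric])

lemma openin_norm_ball:
  assumes "c \<in> X" shows "openin (norm_topology X N) (norm_ball c e)"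
proof -
  have "norm_ball c e = Metric_space.mball X (norm_dist X N) c e"
    using assms by (auto simp: norm_ball_def Metric_space.in_mball[OF metric] norm_dist_def)
  then show ?thesis
    by (simp add: norm_topology_def Metric_space.openin_mball[OF metric])
qed

lemma centre_in_norm_ball:
  assumes "c \<in> X" "e > 0" shows "c \<in> norm_ball c e"
  using dominated[OF \<open>c \<in> X\<close>, of 0 0 "\<lambda>_. 0"] assms by (simp add: norm_ball_def)

lemma unit_ball_coordinate: "x \<in> norm_ball (\<lambda>_. 0) 1 \<Longrightarrow> norm (x i) < 1"
  using coordinate[OF diff(1)[OF zero_in], of x i] by (simp add: norm_ball_def)

text \<open>At the end of a block \<open>B\<^sup>n x\<close> has first coordinate \<open>x n\<close>, so \<open>B\<^sup>n\<close> cannot take a vector of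
the unit ball close to twice the first unit vector.\<close>

lemma not_mixing: "\<not> mixing (norm_topology X N) B"
proof
  assume mix: "mixing (norm_topology X N) B"
  define c :: "nat \<Rightarrow> complex" where "c = (\<lambda>n. 2 * unit_seq n)"
  have c: "c \<in> X" unfolding c_def by (rule unit_in)
  let ?R = "return_set B (norm_ball (\<lambda>_. 0) 1) (norm_ball c 1)"
  have "openin (norm_topology X N) (norm_ball (\<lambda>_. 0) 1)" "norm_ball (\<lambda>_. 0) 1 \<noteq> {}"
    "openin (norm_topology X N) (norm_ball c 1)" "norm_ball c 1 \<noteq> {}"
    using openin_norm_ball centre_in_norm_ball[of _ 1] zero_in c zero_less_one by blast+
  then have fin: "finite (- ?R)" using mix unfolding mixing_def by blast
  have "period 0 s - 1 \<in> - ?R" for s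
  proof (rule ComplI)
    let ?n = "period 0 s - 1"
    assume "?n \<in> ?R"
    then obtain x where x: "x \<in> norm_ball (\<lambda>_. 0) 1" "(B ^^ ?n) x \<in> norm_ball c 1"
      unfolding return_set_def by blast
    have "norm (2 - (B ^^ ?n) x 0) < 1"
      using coordinate[OF diff(1)[OF c], of "(B ^^ ?n) x" 0] x(2)
      by (simp add: norm_ball_def c_def unit_seq_def)
    moreover have "(B ^^ ?n) x 0 = x ?n"
      by (simp add: tower_shift_power growth_def height_period_pred del: One_nat_def)
    ultimately have "norm (2 - x ?n) < 1" by simp
    moreover have "norm (2::complex) \<le> norm (2 - x ?n) + norm (x ?n)"
      using norm_triangle_ineq[of "2 - x ?n" "x ?n"] by simp
    ultimately show False using unit_ball_coordinate[OF x(1), of ?n] by simp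
  qed
  moreover obtain b where "\<forall>n \<in> - ?R. n \<le> b" using fin finite_nat_set_iff_bounded_le by blast
  ultimately have "period 0 (Suc b) - 1 \<le> b" by blast
  then show False using period_gt[of "Suc b" 0] by simp
qed

text \<open>Membership in the image of the unit ball forces all coordinates of \<open>S\<^sub>n y\<close> to be smaller than 1.\<close>

lemma image_of_unit_ball_growth:
  assumes "y \<in> (B ^^ n) ` norm_ball (\<lambda>_. 0) 1"
  shows "norm (y j) * growth j < growth (j + n)"
proof -
  obtain x where x: "x \<in> norm_ball (\<lambda>_. 0) 1" "y = (B ^^ n) x" using assms by blast
  have "norm (y j) * growth j = growth (j + n) * norm (x (j + n))"
    using growth_pos[of j] growth_pos[of "j + n"]
    by (simp add: x(2) tower_shift_power norm_mult norm_divide del: growth_pos)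
  also have "\<dots> < growth (j + n) * 1"
    using unit_ball_coordinate[OF x(1)] by (intro mult_strict_left_mono) auto
  finally show ?thesis by simp
qed

text \<open>The gliding hump makes the uniform boundedness principle explicit: the \<open>i\<close>-th hump has height
\<open>2 ^ - i\<close>, so that the vector is absolutely summable, and sits where some \<open>S\<^sub>n\<close> with \<open>n = nk k\<close>, \<open>k \<ge> i\<close>,
stretches by at least \<open>2 ^ i\<close>.\<close>

lemma not_ultra_hypercyclic: "\<not> ultra_hypercyclic (norm_topology X N) B"
proof
  assume "ultra_hypercyclic (norm_topology X N) B"
  then obtain nk :: "nat \<Rightarrow> nat" where "strict_mono_on {1..} nk" "\<forall>k\<ge>1. nk k > 0"
    and nk: "\<forall>U. openin (norm_topology X N) U \<and> U \<noteq> {} \<longrightarrow>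
      X = (\<Union>i\<in>{1..}. \<Inter>k\<in>{i..}. (B ^^ nk k) ` U)"
    unfolding ultra_hypercyclic_def topspace_norm_topology by (elim exE conjE) (rule that)
  have "X = (\<Union>i\<in>{1..}. \<Inter>k\<in>{i..}. (B ^^ nk k) ` norm_ball (\<lambda>_. 0) 1)"
    using centre_in_norm_ball[OF zero_in zero_less_one]
    by (intro nk[rule_format] conjI openin_norm_ball zero_in) auto
  then have sub: "X \<subseteq> (\<Union>i\<in>{1..}. \<Inter>k\<in>{i..}. (B ^^ nk k) ` norm_ball (\<lambda>_. 0) 1)"
    by (rule equalityD1)
  have ev: "\<exists>i. \<forall>k\<ge>i. y \<in> (B ^^ nk k) ` norm_ball (\<lambda>_. 0) 1" if "y \<in> X" for y
  proof -
    from subsetD[OF sub that] obtain i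
      where "y \<in> (\<Inter>k\<in>{i..}. (B ^^ nk k) ` norm_ball (\<lambda>_. 0) 1)" by (rule UN_E)
    then show ?thesis by (intro exI[of _ i]) simp
  qed
  have hump: "\<exists>j>b. \<exists>k\<ge>i. growth j \<ge> 2 ^ i * growth (j + nk k)" for b i :: nat
  proof -
    have "(\<lambda>n. 2 ^ i * unit_seq n) \<in> X" by (rule unit_in)
    then obtain i' where i': "\<And>k. k \<ge> i' \<Longrightarrow>
        (\<lambda>n. 2 ^ i * unit_seq n) \<in> (B ^^ nk k) ` norm_ball (\<lambda>_. 0) 1"
      using ev by blast
    define k where "k = max i i'"
    have big: "growth (nk k) > 2 ^ i"
      using image_of_unit_ball_growth[OF i', of k 0] by (simp add: k_def unit_seq_def norm_power)
    \<comment> \<open>Any block length exceeding \<open>b + nk k + 1\<close> places the hump beyond \<open>b\<close>.\<close>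
    define L where "L = period 0 (b + nk k + 2)"
    have L: "L > b + nk k + 2" unfolding L_def by (rule period_gt)
    have "height 0 (L - 1 - nk k) = height 0 (nk k)"
      using L unfolding L_def by (intro height_palindrome) simp
    then have "growth (L - 1 - nk k) \<ge> 2 ^ i" using big by (simp add: growth_def)
    moreover have "growth (L - 1 - nk k + nk k) = 1"
      using L height_period_pred[of 0 "b + nk k + 2"] by (simp add: growth_def L_def)
    moreover have "L - 1 - nk k > b" using L by simp
    ultimately show ?thesis by (intro exI[of _ "L - 1 - nk k"] conjI exI[of _ k]) (auto simp: k_def)
  qed
  obtain J where J: "strict_mono J"
    "\<And>i. \<exists>k\<ge>i. growth (J i) \<ge> 2 ^ i * growth (J i + nk k)"
  proof -
    have "\<exists>J. \<forall>i. (\<exists>k\<ge>i. growth (J i) \<ge> 2 ^ i * growth (J i + nk k)) \<and> J i < J (Suc i)"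
      using hump by (intro dependent_nat_choice) blast+
    then show ?thesis using that by (auto simp: strict_mono_Suc_iff)
  qed
  have inj: "inj J" using J(1) by (rule strict_mono_imp_inj_on)
  \<comment> \<open>The sum of \<open>2 ^ - i\<close> times the unit vector at \<open>J i\<close>.\<close>
  define y :: "nat \<Rightarrow> complex" where
    "y j = (if j \<in> range J then (1 / 2) ^ inv J j else 0)" for j
  have yJ: "y (J i) = (1 / 2) ^ i" for i by (simp add: y_def inv_f_f[OF inj])
  have "summable (\<lambda>i. norm (y (J i)))" by (simp add: yJ norm_power norm_divide)
  then have "summable (\<lambda>j. norm (y j))"
    by (rule iffD1[OF summable_mono_reindex[OF J(1)], rotated]) (simp add: y_def)
  then have "y \<in> X" by (rule absolutely_summable)
  from ev[OF this] obtain i where i: "\<And>k. k \<ge> i \<Longrightarrow> y \<in> (B ^^ nk k) ` norm_ball (\<lambda>_. 0) 1" by blast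
  obtain k where k: "k \<ge> i" "growth (J i) \<ge> 2 ^ i * growth (J i + nk k)" using J(2) by blast
  have "growth (J i + nk k) \<le> norm (y (J i)) * growth (J i)"
    using k(2) by (simp add: yJ norm_power norm_divide power_divide field_simps)
  then show False using image_of_unit_ball_growth[OF i[OF k(1)], of "J i"] by simp
qed

text \<open>This is \<open>S\<^sub>n y\<close> moved \<open>n\<close> places to the right: the preimage of \<open>y\<close> under \<open>B\<^sup>n\<close> whose first \<open>n\<close>
coordinates vanish.\<close>

definition right_inverse :: "nat \<Rightarrow> (nat \<Rightarrow> complex) \<Rightarrow> (nat \<Rightarrow> complex)" where
  "right_inverse n y = (\<lambda>i. if i < n then 0 else of_real (growth (i - n) / growth i) * y (i - n))"

lemma right_inverse_bound:
  assumes "y \<in> X" "C \<ge> 0" and C: "\<And>j. y j \<noteq> 0 \<Longrightarrow> growth j \<le> C * growth (j + n)"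
  shows "right_inverse n y \<in> X \<and> N (right_inverse n y) \<le> C * N y"
proof (rule dominated)
  fix i
  show "norm (right_inverse n y (i + n)) \<le> C * norm (y i)"
  proof (cases "y i = 0")
    case False
    then have "growth i / growth (i + n) \<le> C" using C by (simp add: divide_le_eq)
    then have "growth i / growth (i + n) * norm (y i) \<le> C * norm (y i)"
      by (rule mult_right_mono) simp
    then show ?thesis
      by (simp add: right_inverse_def norm_mult norm_divide abs_of_pos)
  qed (simp add: right_inverse_def)
qed (use assms in \<open>auto simp: right_inverse_def\<close>)

text \<open>Split \<open>y\<close> at the block length. On the head, which lies in the initial block, the shift gains a factor
\<open>2 ^ k\<close>; on the tail it loses at most the same factor.\<close>

lemma right_inverse_period_bound:
  assumes y: "y \<in> X" and k: "peak s = k"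
  defines "n \<equiv> k * period 0 s"
  shows "right_inverse n y \<in> X"
    and "N (right_inverse n y) \<le> N y / 2 ^ k + 2 ^ k * N (tail (period 0 s) y)"
proof -
  let ?L = "period 0 s"
  define head where "head = (\<lambda>i. y i - tail ?L y i)"
  have head: "head \<in> X" "N head \<le> N y"
    by (rule solid[OF y], simp add: head_def tail_def)+
  have h: "right_inverse n head \<in> X \<and> N (right_inverse n head) \<le> 1 / 2 ^ k * N head"
  proof (rule right_inverse_bound[OF head(1)])
    fix j assume "head j \<noteq> 0"
    then have "j < ?L" by (auto simp: head_def tail_def split: if_splits)
    then have "height 0 (j + n) = height 0 j + k"
      using height_raised_copy[of j 0 s k] k by (simp add: n_def)
    then show "growth j \<le> 1 / 2 ^ k * growth (j + n)" by (simp add: growth_def power_add)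
  qed simp
  have t: "right_inverse n (tail ?L y) \<in> X \<and> N (right_inverse n (tail ?L y)) \<le> 2 ^ k * N (tail ?L y)"
  proof (rule right_inverse_bound[OF tail_in[OF y]])
    fix j
    have "growth j \<le> 2 ^ (k + height 0 (j + n))"
      unfolding growth_def n_def by (intro power_increasing height_add_multiple_period) simp
    then show "growth j \<le> 2 ^ k * growth (j + n)" by (simp add: growth_def power_add)
  qed simp
  have eq: "right_inverse n y = (\<lambda>i. right_inverse n head i + right_inverse n (tail ?L y) i)"
    by (auto simp: right_inverse_def head_def algebra_simps fun_eq_iff)
  show "right_inverse n y \<in> X" unfolding eq using add h t by blast
  have "N (right_inverse n y) \<le> N (right_inverse n head) + N (right_inverse n (tail ?L y))"
    unfolding eq using add h t by blast
  also have "\<dots> \<le> 1 / 2 ^ k * N y + 2 ^ k * N (tail ?L y)"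
    using h t head(2) by (intro add_mono order_trans[OF conjunct2[OF h]] mult_left_mono) auto
  finally show "N (right_inverse n y) \<le> N y / 2 ^ k + 2 ^ k * N (tail ?L y)" by simp
qed

text \<open>The peak \<open>k\<close> is fixed first, to make the head small. Since \<open>k\<close> is the peak of arbitrarily late stages, the
block length can then be chosen so large that the tail survives the factor \<open>2 ^ k\<close>.\<close>

lemma small_right_inverse:
  assumes y: "y \<in> X" and "e > 0"
  shows "\<exists>n\<ge>b. right_inverse n y \<in> X \<and> N (right_inverse n y) < e"
proof -
  obtain a where a: "N y / (e / 2) < 2 ^ a" using real_arch_pow[of 2] by auto
  define k where "k = Suc a"
  have k: "N y / 2 ^ k < e / 2"
  proof -
    have "N y / (e / 2) < 2 ^ k" using a less_le_trans[of _ "2 ^ a" "2 ^ k :: real"] by (simp add: k_def)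
    then show ?thesis using \<open>e > 0\<close> by (simp add: field_simps)
  qed
  have "\<forall>\<^sub>F J in sequentially. N (tail J y) < e / 2 / 2 ^ k"
    using tail_null[OF y] \<open>e > 0\<close> by (intro order_tendstoD(2)) auto
  then obtain J0 where J0: "\<And>J. J \<ge> J0 \<Longrightarrow> N (tail J y) < e / 2 / 2 ^ k"
    by (auto simp: eventually_sequentially)
  define s where "s = prod_encode (a, max b J0)"
  have s: "peak s = k" by (simp add: peak_def s_def k_def)
  have "max b J0 \<le> s" unfolding s_def by (rule le_prod_encode_2)
  then have L: "period 0 s \<ge> max b J0" using period_gt[of s 0] by simp
  have "k * period 0 s \<ge> b" using L by (simp add: k_def)
  moreover have "2 ^ k * N (tail (period 0 s) y) < e / 2"
    using J0[of "period 0 s"] L by (simp add: field_simps)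
  moreover note right_inverse_period_bound[OF y s] k
  ultimately have "N (right_inverse (k * period 0 s) y) < e" by linarith
  then show ?thesis
    using \<open>k * period 0 s \<ge> b\<close> right_inverse_period_bound(1)[OF y s] by blast
qed

text \<open>Keep the first \<open>n\<close> coordinates of a point \<open>u\<close> of \<open>U\<close> and continue with \<open>S\<^sub>n y\<close>. The result differs from
\<open>u\<close> by the tail of \<open>u\<close> and a small vector, and \<open>B\<^sup>n\<close> maps it to \<open>y\<close>.\<close>

lemma strongly_hypercyclic_tower: "strongly_hypercyclic (norm_topology X N) B"
proof -
  have "\<exists>n. y \<in> (B ^^ n) ` U" if U: "openin (norm_topology X N) U" "U \<noteq> {}" and y: "y \<in> X" for U y
  proof -
    obtain u e where u: "u \<in> U" "u \<in> X" "e > 0" "\<And>x. x \<in> X \<Longrightarrow> N (\<lambda>n. u n - x n) < e \<Longrightarrow> x \<in> U"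
      using U unfolding openin_norm_topology[OF metric] by blast
    have "\<forall>\<^sub>F J in sequentially. N (tail J u) < e / 2"
      using tail_null[OF u(2)] u(3) by (intro order_tendstoD(2)) auto
    then obtain b where b: "\<And>J. J \<ge> b \<Longrightarrow> N (tail J u) < e / 2"
      by (auto simp: eventually_sequentially)
    obtain n where n: "n \<ge> b" "right_inverse n y \<in> X" "N (right_inverse n y) < e / 2"
      using small_right_inverse[OF y, of "e / 2" b] u(3) by auto
    define v where "v = (\<lambda>i. tail n u i - right_inverse n y i)"
    have v: "v \<in> X" "N v \<le> N (tail n u) + N (right_inverse n y)"
      unfolding v_def by (rule diff[OF tail_in[OF u(2)] n(2)])+
    define x where "x = (\<lambda>i. u i - v i)"
    have "x \<in> X" unfolding x_def by (rule diff(1)[OF u(2) v(1)])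
    moreover have "(\<lambda>i. u i - x i) = v" by (simp add: x_def)
    ultimately have "x \<in> U" using u(4) v(2) b[OF n(1)] n(3) by simp
    moreover have "(B ^^ n) x = y"
      using less_imp_neq[OF growth_pos, symmetric]
      by (simp add: tower_shift_power x_def v_def tail_def right_inverse_def fun_eq_iff)
    ultimately show ?thesis by blast
  qed
  then show ?thesis unfolding strongly_hypercyclic_def topspace_norm_topology by blast
qed

end

section \<open>The classical sequence spaces\<close>

interpretation c0: solid_sequence_space c0 c0_norm
proof (rule solid_sequence_space.intro)
  show "Metric_space c0 (norm_dist c0 c0_norm)" by (rule Metric_space_c0)
next
  fix x y :: "nat \<Rightarrow> complex"
  show "norm (x i) \<le> c0_norm x" if "x \<in> c0" for i using that by (rule c0_norm_upper)
  show "(\<lambda>n. x n + y n) \<in> c0 \<and> c0_norm (\<lambda>n. x n + y n) \<le> c0_norm x + c0_norm y"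
    if "x \<in> c0" "y \<in> c0"
  proof
    show "(\<lambda>n. x n + y n) \<in> c0" using that tendsto_add[of x 0 sequentially y 0] by (simp add: c0_def)
    show "c0_norm (\<lambda>n. x n + y n) \<le> c0_norm x + c0_norm y"
      by (intro c0_norm_le norm_triangle_le add_mono c0_norm_upper that)
  qed
next
  fix y z :: "nat \<Rightarrow> complex" and C n
  assume y: "y \<in> c0" and C: "C \<ge> 0" and z0: "\<And>i. i < n \<Longrightarrow> z i = 0"
    and z: "\<And>i. norm (z (i + n)) \<le> C * norm (y i)"
  show "z \<in> c0 \<and> c0_norm z \<le> C * c0_norm y"
  proof
    have "(\<lambda>i. C * norm (y i)) \<longlonglongrightarrow> 0"
      using y by (auto simp: c0_def intro!: tendsto_mult_right_zero tendsto_norm_zero)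
    then have "(\<lambda>i. z (i + n)) \<longlonglongrightarrow> 0"
      by (rule Lim_null_comparison[rotated]) (simp add: z)
    then show "z \<in> c0" unfolding c0_def by (simp add: LIMSEQ_offset)
    show "c0_norm z \<le> C * c0_norm y"
    proof (rule c0_norm_le)
      fix i
      show "norm (z i) \<le> C * c0_norm y"
      proof (cases "i < n")
        case True
        then show ?thesis
          using z0 C order_trans[OF norm_ge_zero c0_norm_upper[OF y, of 0]] by simp
      next
        case False
        then show ?thesis
          using order_trans[OF z[of "i - n"] mult_left_mono[OF c0_norm_upper[OF y] C]] by simp
      qed
    qed
  qed
next
  fix x :: "nat \<Rightarrow> complex"
  show "(\<lambda>J. c0_norm (tail J x)) \<longlonglongrightarrow> 0" if "x \<in> c0"
  proof (rule LIMSEQ_I)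
    fix e :: real assume "e > 0"
    have "x \<longlonglongrightarrow> 0" using that by (simp add: c0_def)
    then obtain J0 where J0: "\<And>i. i \<ge> J0 \<Longrightarrow> norm (x i) < e / 2"
      using LIMSEQ_D[of x 0 "e / 2"] \<open>e > 0\<close> by auto
    have "norm (c0_norm (tail J x) - 0) < e" if "J \<ge> J0" for J
    proof -
      have "c0_norm (tail J x) \<le> e / 2"
        using J0 that \<open>e > 0\<close> by (intro c0_norm_le) (auto simp: tail_def less_imp_le)
      moreover have "tail J x \<in> c0"
        using Lim_null_comparison[OF _ tendsto_norm_zero[OF \<open>x \<longlonglongrightarrow> 0\<close>], of "tail J x"]
        by (simp add: c0_def tail_def)
      then have "c0_norm (tail J x) \<ge> 0"
        using order_trans[OF norm_ge_zero c0_norm_upper] by blast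
      ultimately show ?thesis using \<open>e > 0\<close> by simp
    qed
    then show "\<exists>no. \<forall>J\<ge>no. norm (c0_norm (tail J x) - 0) < e" by blast
  qed
  show "x \<in> c0" if "summable (\<lambda>n. norm (x n))"
    using summable_LIMSEQ_zero[OF that] by (simp add: c0_def tendsto_norm_zero_iff)
qed

lemma solid_sequence_space_lp:
  assumes p: "p \<ge> 1" shows "solid_sequence_space (lp p) (lp_norm p)"
proof (rule solid_sequence_space.intro)
  show "Metric_space (lp p) (norm_dist (lp p) (lp_norm p))" using p by (rule Metric_space_lp)
next
  fix x y :: "nat \<Rightarrow> complex"
  show "(\<lambda>n. x n + y n) \<in> lp p \<and> lp_norm p (\<lambda>n. x n + y n) \<le> lp_norm p x + lp_norm p y"
    if "x \<in> lp p" "y \<in> lp p" using p that by (rule lp_minkowski)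
  show "norm (x i) \<le> lp_norm p x" if x: "x \<in> lp p" for i
  proof -
    have "norm (x i) powr p \<le> (\<Sum>n. norm (x n) powr p)"
      using x sum_le_suminf[of "\<lambda>n. norm (x n) powr p" "{i}"] by (simp add: lp_def)
    then have "(norm (x i) powr p) powr (1 / p) \<le> lp_norm p x"
      unfolding lp_norm_def using p by (intro powr_mono2) auto
    then show ?thesis using p by (simp add: powr_powr)
  qed
next
  fix y z :: "nat \<Rightarrow> complex" and C n
  assume y: "y \<in> lp p" and C: "C \<ge> 0" and z0: "\<And>i. i < n \<Longrightarrow> z i = 0"
    and z: "\<And>i. norm (z (i + n)) \<le> C * norm (y i)"
  show "z \<in> lp p \<and> lp_norm p z \<le> C * lp_norm p y"
  proof
    have le: "norm (z (i + n)) powr p \<le> C powr p * norm (y i) powr p" for i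
      using powr_mono2[OF _ _ z, of p i] p C by (simp add: powr_mult)
    have Sy: "summable (\<lambda>i. norm (y i) powr p)" using y by (simp add: lp_def)
    have Sz': "summable (\<lambda>i. norm (z (i + n)) powr p)"
      using le by (intro summable_comparison_test'[OF summable_mult[OF Sy], of 0]) auto
    then have Sz: "summable (\<lambda>i. norm (z i) powr p)"
      by (rule iffD1[OF summable_iff_shift])
    then show "z \<in> lp p" by (simp add: lp_def)
    have "(\<Sum>i. norm (z i) powr p) = (\<Sum>i. norm (z (i + n)) powr p)"
      using suminf_split_initial_segment[OF Sz, of n] z0 by simp
    also have "\<dots> \<le> C powr p * (\<Sum>i. norm (y i) powr p)"
      unfolding suminf_mult[OF Sy, symmetric] by (intro suminf_le le Sz' summable_mult Sy)
    finally have "lp_norm p z \<le> (C powr p * (\<Sum>i. norm (y i) powr p)) powr (1 / p)"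
      unfolding lp_norm_def using p by (intro powr_mono2 suminf_nonneg Sz) auto
    also have "\<dots> = C * lp_norm p y"
      using p C Sy by (simp add: lp_norm_def powr_mult suminf_nonneg powr_powr)
    finally show "lp_norm p z \<le> C * lp_norm p y" .
  qed
next
  fix x :: "nat \<Rightarrow> complex"
  show "(\<lambda>J. lp_norm p (tail J x)) \<longlonglongrightarrow> 0" if x: "x \<in> lp p"
  proof -
    have S: "summable (\<lambda>i. norm (x i) powr p)" using x by (simp add: lp_def)
    have eq: "(\<Sum>i. norm (tail J x i) powr p) = (\<Sum>i. norm (x (i + J)) powr p)" for J
    proof -
      have "summable (\<lambda>i. norm (tail J x i) powr p)"
        by (intro summable_comparison_test'[OF S, of 0]) (auto simp: tail_def)
      from suminf_split_initial_segment[OF this, of J] show ?thesis by (simp add: tail_def)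
    qed
    have "(\<lambda>J. \<Sum>i. norm (x (i + J)) powr p) \<longlonglongrightarrow> 0"
      using S by (rule suminf_exist_split2)
    then show ?thesis unfolding lp_norm_def eq
      using p tendsto_powr'[of "\<lambda>J. \<Sum>i. norm (x (i + J)) powr p" 0 sequentially "\<lambda>_. 1 / p" "1 / p"]
        S summable_iff_shift[of "\<lambda>i. norm (x i) powr p"]
      by (auto simp: suminf_nonneg)
  qed
  show "x \<in> lp p" if S: "summable (\<lambda>n. norm (x n))"
  proof -
    have "\<forall>\<^sub>F n in sequentially. norm (x n) < 1"
      using summable_LIMSEQ_zero[OF S] by (rule order_tendstoD(2)) simp
    then have "\<forall>\<^sub>F n in sequentially. norm (norm (x n) powr p) \<le> norm (x n)"
    proof eventually_elim
      case (elim n)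
      then show ?case using powr_mono'[of 1 p "norm (x n)"] p by simp
    qed
    then have "summable (\<lambda>n. norm (x n) powr p)" using S by (rule summable_comparison_test_ev)
    then show ?thesis by (simp add: lp_def)
  qed
qed

theorem theorem2p12:
  shows "(\<exists>w. shift_weight w \<and>
            strongly_hypercyclic c0_top (weighted_shift w) \<and>
            \<not> ultra_hypercyclic c0_top (weighted_shift w) \<and>
            \<not> mixing c0_top (weighted_shift w)) \<and>
         (\<forall>p::real. p \<ge> 1 \<longrightarrow>
           (\<exists>w. shift_weight w \<and>
            strongly_hypercyclic (lp_top p) (weighted_shift w) \<and>
            \<not> ultra_hypercyclic (lp_top p) (weighted_shift w) \<and>
            \<not> mixing (lp_top p) (weighted_shift w)))"
proof (intro conjI allI impI exI[of _ tower_weight] shift_weight_tower)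
  fix p :: real assume "p \<ge> 1"
  then interpret lp: solid_sequence_space "lp p" "lp_norm p" by (rule solid_sequence_space_lp)
  show "strongly_hypercyclic (lp_top p) (weighted_shift tower_weight)"
    by (rule lp.strongly_hypercyclic_tower)
  show "\<not> ultra_hypercyclic (lp_top p) (weighted_shift tower_weight)"
    by (rule lp.not_ultra_hypercyclic)
  show "\<not> mixing (lp_top p) (weighted_shift tower_weight)"
    by (rule lp.not_mixing)
qed (fact c0.strongly_hypercyclic_tower c0.not_ultra_hypercyclic c0.not_mixing)+

end
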